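(* (a) For $m\ge 1$ the form $I([[0_m]])$ has $\lfloor\frac m2\rfloor$ negative and $\lfloor\frac m2\rfloor$ positive eigenvalues; for odd $m$ it has in addition a zero eigenvalue. Thus the inertia indices of $[[0_m]]$ are $(i_+,i_-,i_0)=(k,k,0)$ if $m=2k$ and $(k,k,1)$ if $m=2k+1$, and the discriminants are $\delta([[0_{2k}]])=(-1)^k$ and $\delta([[0_{2k+1}]])=0$ for all $k\ge 0$. (b) If $L=[[0_{2k},w_1,\dots,w_n]]$ and $L'=[[w_1,\dots,w_n]]$, then $$I(L)\sim I(L')\oplus I([[0_{2k}]])\sim I(L')\oplus\bigoplus_{i=1}^k\langle 0,0\rangle .$$ Consequently, if $w_i\le -2$ for all $i=1,\dots,n$, then the intersection form $$I(L)\sim\langle w_1'\rangle\oplus\langle w_2'\rangle\oplus\dots\oplus\langle w_n'\rangle\oplus I([[0_{2k}]])$$ has $n+k$ negative and $k$ positive eigenvalues, and $\delta(L)=(-1)^k\delta(L')$. Here $w_i'=-[-w_i,\dots,-w_n]$ for $i=1,\dots,n$.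
   Context: $[[w_1,\dots,w_n]]$ denotes the weighted linear chain (path graph) with consecutive vertices $v_1,\dots,v_n$ of integer weights $w_i=v_i^2$; inside brackets $0_m$ denotes $m$ consecutive entries $0$. For a weighted graph $\Gamma$ (without loops and multiple edges) with vertices $v_i$, $I(\Gamma)=(v_i.v_j)$ is its adjacency (intersection) matrix: $v_i.v_i=v_i^2$ is the weight of $v_i$, and for $i\ne j$, $v_i.v_j=1$ if $v_i$ and $v_j$ are joined by an edge and $0$ otherwise. It is regarded as a real symmetric bilinear form; $\sim$ denotes equivalence of real symmetric bilinear forms. The inertia indices $i_+,i_-,i_0$ are the numbers of positive, negative and zero eigenvalues. The discriminant is $\delta(\Gamma)=\det(-I(\Gamma))$ (equal to $1$ for the empty graph). $\langle a\rangle$ is the one-dimensional form $ax^2$, and $\langle a,b\rangle$ is the form with matrix $\begin{pmatrix}a&1\\1&b\end{pmatrix}$. The continued fraction $[k_1,\dots,k_n]$ means $k_1-\cfrac{1}{k_2-\cfrac{1}{\ddots-\cfrac{1}{k_n}}}$. *)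

theory Defs
  imports Jordan_Normal_Form.Char_Poly
begin

text \<open>Vertices are numbered from 0; an edge is the set of its two end points, so that graphs are
  undirected and without multiple edges.\<close>

record weighted_graph =
  order_of :: nat
  weight :: "nat \<Rightarrow> int"
  edges :: "nat set set"

definition chain :: "int list \<Rightarrow> weighted_graph" where
  "chain ws = \<lparr> order_of = length ws, weight = (\<lambda>i. ws ! i),
                edges = {{i, Suc i} | i. Suc i < length ws} \<rparr>"

definition intersection_mat :: "weighted_graph \<Rightarrow> real mat" where
  "intersection_mat \<Gamma> = mat (order_of \<Gamma>) (order_of \<Gamma>)
     (\<lambda>(i, j). if i = j then of_int (weight \<Gamma> i) else if {i, j} \<in> edges \<Gamma> then 1 else 0)"

definition discriminant :: "weighted_graph \<Rightarrow> real" where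
  "discriminant \<Gamma> = det (- intersection_mat \<Gamma>)"

text \<open>Bilinear forms are given by their matrices; equivalence is a change of basis, i.e. congruence.
  Orthogonal sums of forms are block diagonal matrices (\<open>diag_block_mat\<close>).\<close>

definition form_equiv :: "real mat \<Rightarrow> real mat \<Rightarrow> bool" (infix "\<sim>\<^sub>f" 50) where
  "A \<sim>\<^sub>f B \<longleftrightarrow> (\<exists>n. A \<in> carrier_mat n n \<and> B \<in> carrier_mat n n \<and>
     (\<exists>P \<in> carrier_mat n n. invertible_mat P \<and> B = P\<^sup>T * A * P))"

definition form1 :: "real \<Rightarrow> real mat" where
  "form1 a = mat_of_rows_list 1 [[a]]"

definition form2 :: "real \<Rightarrow> real \<Rightarrow> real mat" where
  "form2 a b = mat_of_rows_list 2 [[a, 1], [1, b]]"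

text \<open>Eigenvalues are counted with algebraic multiplicity; for the symmetric matrices considered
  here all eigenvalues are real.\<close>

definition pos_index :: "real mat \<Rightarrow> nat" where
  "pos_index A = (\<Sum>x | eigenvalue A x \<and> x > 0. order x (char_poly A))"

definition neg_index :: "real mat \<Rightarrow> nat" where
  "neg_index A = (\<Sum>x | eigenvalue A x \<and> x < 0. order x (char_poly A))"

definition null_index :: "real mat \<Rightarrow> nat" where
  "null_index A = (\<Sum>x | eigenvalue A x \<and> x = 0. order x (char_poly A))"

definition inertia :: "real mat \<Rightarrow> nat \<times> nat \<times> nat" where
  "inertia A = (pos_index A, neg_index A, null_index A)"

text \<open>The value on the empty list is deliberately left unspecified.\<close>

fun cont_frac :: "real list \<Rightarrow> real" where
  "cont_frac [k] = k"
| "cont_frac (k # l # ls) = k - 1 / cont_frac (l # ls)"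

text \<open>With the indexing from 0, \<open>reduced_weight ws i\<close> is $w'_{i+1} = -[-w_{i+1},\dots,-w_n]$.\<close>

definition reduced_weight :: "int list \<Rightarrow> nat \<Rightarrow> real" where
  "reduced_weight ws i = - cont_frac (map (\<lambda>w. - of_int w) (drop i ws))"

end

theory Submission
  imports Defs "Jordan_Normal_Form.Spectral_Radius"
begin

text \<open>If the first two vertices of a chain have weight \<open>0\<close>, replacing \<open>v\<^sub>3\<close> by \<open>v\<^sub>3 - v\<^sub>1\<close> splits off
  \<open>\<langle>0,0\<rangle>\<close> by a change of basis of determinant \<open>1\<close>. Iterating gives the decomposition of \<open>I(L)\<close> and
  the discriminants. A chain with weights at most \<open>-2\<close> is diagonalised by eliminating vertices from
  its last one, which produces the continued fractions \<open>w\<^sub>i' < -1\<close>. Since the inertia indices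
  are defined through eigenvalues, reading them off from a diagonal form requires the spectral
  theorem for real symmetric matrices and Sylvester's law of inertia.\<close>

subsection \<open>Congruence and orthogonal sums\<close>

text \<open>Congruence preserves neither eigenvalues nor determinants. The inertia indices are sums
  of root orders of the characteristic polynomial, hence invariants of similarity, whereas every
  decomposition here is a congruence. An orthogonal change of basis is both at once: it puts the
  actual eigenvalues on the diagonal, and Sylvester's law compares their signs with those of any
  other diagonal form, such as the one found by elimination. A congruence multiplies the determinant
  by the square of that of the base change, so for the discriminant this factor has to be known, not
  merely nonzero.\<close>

lemma invertible_matI:
  assumes "P \<in> carrier_mat n n" "Q \<in> carrier_mat n n" "P * Q = 1\<^sub>m n" "Q * P = 1\<^sub>m n"
  shows "invertible_mat P"
  using assms unfolding invertible_mat_def inverts_mat_def by auto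

lemma invertible_matE:
  assumes "invertible_mat P" "P \<in> carrier_mat n n"
  obtains Q where "Q \<in> carrier_mat n n" "P * Q = 1\<^sub>m n" "Q * P = 1\<^sub>m n"
proof -
  from assms obtain Q where "inverts_mat P Q" "inverts_mat Q P"
    unfolding invertible_mat_def by auto
  then have *: "P * Q = 1\<^sub>m n" "Q * P = 1\<^sub>m (dim_row Q)"
    using assms(2) unfolding inverts_mat_def by auto
  have "dim_col Q = n" by (metis *(1) index_mult_mat(3) index_one_mat(3))
  moreover have "dim_row Q = n" by (metis *(2) assms(2) carrier_matD(2) index_mult_mat(3) index_one_mat(3))
  ultimately show ?thesis using * by (intro that[of Q]) auto
qed

lemma invertible_mat_det:
  fixes P :: "real mat"
  assumes P: "P \<in> carrier_mat n n" and "det P \<noteq> 0"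
  shows "invertible_mat P"
proof -
  \<comment> \<open>The matrix ring is an extensible record; \<open>undefined\<close> fills its
    extension slot.\<close>
  from det_non_zero_imp_unit[OF assms, of undefined] show ?thesis
    using P by (auto simp: Units_def ring_mat_def intro: invertible_matI)
qed

lemma form_equivI:
  assumes "A \<in> carrier_mat n n" "P \<in> carrier_mat n n" "invertible_mat P" "B = P\<^sup>T * A * P"
  shows "A \<sim>\<^sub>f B"
  using assms unfolding form_equiv_def by (intro exI[of _ n]) auto

lemma form_equivE:
  assumes "A \<sim>\<^sub>f B"
  obtains n P Q where "A \<in> carrier_mat n n" "B \<in> carrier_mat n n" "P \<in> carrier_mat n n"
    "Q \<in> carrier_mat n n" "P * Q = 1\<^sub>m n" "Q * P = 1\<^sub>m n" "B = P\<^sup>T * A * P"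
  using assms unfolding form_equiv_def by (metis invertible_matE)

lemma congruence_mult:
  fixes A :: "'a :: comm_ring_1 mat"
  assumes "A \<in> carrier_mat n n" "P \<in> carrier_mat n n" "Q \<in> carrier_mat n n"
  shows "Q\<^sup>T * (P\<^sup>T * A * P) * Q = (P * Q)\<^sup>T * A * (P * Q)"
proof -
  have "(P * Q)\<^sup>T = Q\<^sup>T * P\<^sup>T" using assms by (intro transpose_mult)
  then show ?thesis using assms by (simp add: assoc_mult_mat[of _ n n _ n _ n])
qed

lemma form_equiv_refl:
  assumes "A \<in> carrier_mat n n"
  shows "A \<sim>\<^sub>f A"
  using assms by (intro form_equivI[of _ n "1\<^sub>m n"] invertible_matI[of _ n "1\<^sub>m n"]) auto

lemma form_equiv_sym:
  assumes "A \<sim>\<^sub>f B"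
  shows "B \<sim>\<^sub>f A"
proof -
  from assms obtain n P Q where *: "A \<in> carrier_mat n n" "B \<in> carrier_mat n n"
    "P \<in> carrier_mat n n" "Q \<in> carrier_mat n n" "P * Q = 1\<^sub>m n" "Q * P = 1\<^sub>m n" "B = P\<^sup>T * A * P"
    by (rule form_equivE)
  have "Q\<^sup>T * B * Q = A" unfolding *(7) congruence_mult[OF *(1,3,4)] *(5) using *(1) by simp
  moreover have "invertible_mat Q" by (rule invertible_matI[OF *(4,3,6,5)])
  ultimately show ?thesis by (intro form_equivI[OF *(2,4)]) simp_all
qed

lemma form_equiv_trans [trans]:
  assumes "A \<sim>\<^sub>f B" "B \<sim>\<^sub>f C"
  shows "A \<sim>\<^sub>f C"
proof -
  from assms(1) obtain n P P' where P: "A \<in> carrier_mat n n" "B \<in> carrier_mat n n"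
    "P \<in> carrier_mat n n" "P' \<in> carrier_mat n n" "P * P' = 1\<^sub>m n" "P' * P = 1\<^sub>m n" "B = P\<^sup>T * A * P"
    by (rule form_equivE)
  from assms(2) obtain m Q Q' where Q: "B \<in> carrier_mat m m" "C \<in> carrier_mat m m"
    "Q \<in> carrier_mat m m" "Q' \<in> carrier_mat m m" "Q * Q' = 1\<^sub>m m" "Q' * Q = 1\<^sub>m m" "C = Q\<^sup>T * B * Q"
    by (rule form_equivE)
  have m: "m = n" using P Q by auto
  note Q = Q[unfolded m]
  have "P * Q * (Q' * P') = P * (Q * Q') * P'"
    using P(3,4) Q(3,4) by (simp add: assoc_mult_mat[of _ n n _ n _ n])
  then have 1: "P * Q * (Q' * P') = 1\<^sub>m n" unfolding Q(5) using P(3-5) by simp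
  have "Q' * P' * (P * Q) = Q' * (P' * P) * Q"
    using P(3,4) Q(3,4) by (simp add: assoc_mult_mat[of _ n n _ n _ n])
  then have 2: "Q' * P' * (P * Q) = 1\<^sub>m n" unfolding P(6) using Q(3,4,6) by simp
  show ?thesis
  proof (rule form_equivI[of _ n "P * Q"])
    show "invertible_mat (P * Q)"
      by (rule invertible_matI[OF _ _ 1 2]) (use P(3,4) Q(3,4) in auto)
    show "C = (P * Q)\<^sup>T * A * (P * Q)"
      unfolding Q(7) P(7) by (rule congruence_mult[OF P(1,3) Q(3)])
  qed (use P(1,3) Q(3) in auto)
qed

text \<open>Binary counterpart of \<open>diag_block_mat\<close>, so that congruences can be combined
  summand by summand; \<open>diag_block_mat_Cons\<close> and
  \<open>diag_block_mat_append_direct_sum\<close> translate between the two.\<close>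

definition direct_sum :: "real mat \<Rightarrow> real mat \<Rightarrow> real mat" (infixr "\<oplus>\<^sub>f" 65) where
  "A \<oplus>\<^sub>f B = four_block_mat A (0\<^sub>m (dim_row A) (dim_col B)) (0\<^sub>m (dim_row B) (dim_col A)) B"

lemma dim_direct_sum [simp]:
  "dim_row (A \<oplus>\<^sub>f B) = dim_row A + dim_row B" "dim_col (A \<oplus>\<^sub>f B) = dim_col A + dim_col B"
  by (auto simp: direct_sum_def)

lemma direct_sum_carrier [simp, intro]:
  "A \<in> carrier_mat n n \<Longrightarrow> B \<in> carrier_mat m m \<Longrightarrow> A \<oplus>\<^sub>f B \<in> carrier_mat (n + m) (n + m)"
  by (intro carrier_matI) auto

lemma index_direct_sum:
  assumes "i < dim_row A + dim_row B" "j < dim_col A + dim_col B"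
  shows "(A \<oplus>\<^sub>f B) $$ (i, j) =
    (if i < dim_row A then if j < dim_col A then A $$ (i, j) else 0
     else if j < dim_col A then 0 else B $$ (i - dim_row A, j - dim_col A))"
  using assms unfolding direct_sum_def by auto

lemma direct_sum_assoc: "(A \<oplus>\<^sub>f B) \<oplus>\<^sub>f C = A \<oplus>\<^sub>f (B \<oplus>\<^sub>f C)"
  unfolding direct_sum_def by (rule assoc_four_block_mat[symmetric])

lemma direct_sum_empty [simp]: "A \<oplus>\<^sub>f 0\<^sub>m 0 0 = A" "0\<^sub>m 0 0 \<oplus>\<^sub>f A = A"
  by (auto intro!: eq_matI simp: index_direct_sum)

lemma diag_block_mat_Cons: "diag_block_mat (A # As) = A \<oplus>\<^sub>f diag_block_mat As"
  by (simp add: direct_sum_def Let_def)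

lemma diag_block_mat_append_direct_sum:
  "diag_block_mat (As @ Bs) = diag_block_mat As \<oplus>\<^sub>f diag_block_mat Bs"
  by (simp add: diag_block_mat_append direct_sum_def Let_def)

lemma direct_sum_mult:
  assumes "A \<in> carrier_mat n n" "B \<in> carrier_mat m m" "C \<in> carrier_mat n n" "D \<in> carrier_mat m m"
  shows "(A \<oplus>\<^sub>f B) * (C \<oplus>\<^sub>f D) = (A * C) \<oplus>\<^sub>f (B * D)"
proof -
  have "(A \<oplus>\<^sub>f B) * (C \<oplus>\<^sub>f D) = four_block_mat (A * C + 0\<^sub>m n m * 0\<^sub>m m n) (A * 0\<^sub>m n m + 0\<^sub>m n m * D)
    (0\<^sub>m m n * C + B * 0\<^sub>m m n) (0\<^sub>m m n * 0\<^sub>m n m + B * D)"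
    unfolding direct_sum_def carrier_matD[OF assms(1)] carrier_matD[OF assms(2)]
      carrier_matD[OF assms(3)] carrier_matD[OF assms(4)]
    by (rule mult_four_block_mat) (use assms in auto)
  also have "\<dots> = (A * C) \<oplus>\<^sub>f (B * D)"
    using assms unfolding direct_sum_def by auto
  finally show ?thesis .
qed

lemma direct_sum_transpose: "(A \<oplus>\<^sub>f B)\<^sup>T = A\<^sup>T \<oplus>\<^sub>f B\<^sup>T"
  by (rule eq_matI) (auto simp: index_direct_sum)

lemma direct_sum_one: "1\<^sub>m n \<oplus>\<^sub>f 1\<^sub>m m = 1\<^sub>m (n + m)"
  by (rule eq_matI) (auto simp: index_direct_sum)

lemma direct_sum_congruence:
  assumes "A \<in> carrier_mat n n" "B \<in> carrier_mat m m" "P \<in> carrier_mat n n" "Q \<in> carrier_mat m m"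
  shows "(P \<oplus>\<^sub>f Q)\<^sup>T * (A \<oplus>\<^sub>f B) * (P \<oplus>\<^sub>f Q) = (P\<^sup>T * A * P) \<oplus>\<^sub>f (Q\<^sup>T * B * Q)"
proof -
  have "(P\<^sup>T \<oplus>\<^sub>f Q\<^sup>T) * (A \<oplus>\<^sub>f B) = (P\<^sup>T * A) \<oplus>\<^sub>f (Q\<^sup>T * B)"
    using assms by (intro direct_sum_mult) auto
  also have "\<dots> * (P \<oplus>\<^sub>f Q) = (P\<^sup>T * A * P) \<oplus>\<^sub>f (Q\<^sup>T * B * Q)"
    using assms by (intro direct_sum_mult[of _ n _ m]) auto
  finally show ?thesis unfolding direct_sum_transpose .
qed

lemma form_equiv_direct_sum:
  assumes "A \<sim>\<^sub>f A'" "B \<sim>\<^sub>f B'"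
  shows "A \<oplus>\<^sub>f B \<sim>\<^sub>f A' \<oplus>\<^sub>f B'"
proof -
  from assms(1) obtain n P P' where P: "A \<in> carrier_mat n n" "A' \<in> carrier_mat n n"
    "P \<in> carrier_mat n n" "P' \<in> carrier_mat n n" "P * P' = 1\<^sub>m n" "P' * P = 1\<^sub>m n" "A' = P\<^sup>T * A * P"
    by (rule form_equivE)
  from assms(2) obtain m Q Q' where Q: "B \<in> carrier_mat m m" "B' \<in> carrier_mat m m"
    "Q \<in> carrier_mat m m" "Q' \<in> carrier_mat m m" "Q * Q' = 1\<^sub>m m" "Q' * Q = 1\<^sub>m m" "B' = Q\<^sup>T * B * Q"
    by (rule form_equivE)
  have "invertible_mat (P \<oplus>\<^sub>f Q)"
  proof (rule invertible_matI[of _ "n + m" "P' \<oplus>\<^sub>f Q'"])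
    show "(P \<oplus>\<^sub>f Q) * (P' \<oplus>\<^sub>f Q') = 1\<^sub>m (n + m)"
      unfolding direct_sum_mult[OF P(3) Q(3) P(4) Q(4)] P(5) Q(5) by (rule direct_sum_one)
    show "(P' \<oplus>\<^sub>f Q') * (P \<oplus>\<^sub>f Q) = 1\<^sub>m (n + m)"
      unfolding direct_sum_mult[OF P(4) Q(4) P(3) Q(3)] P(6) Q(6) by (rule direct_sum_one)
  qed (use P(3,4) Q(3,4) in auto)
  moreover have "A' \<oplus>\<^sub>f B' = (P \<oplus>\<^sub>f Q)\<^sup>T * (A \<oplus>\<^sub>f B) * (P \<oplus>\<^sub>f Q)"
    unfolding P(7) Q(7) by (rule direct_sum_congruence[OF P(1) Q(1) P(3) Q(3), symmetric])
  ultimately show ?thesis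
    using P(1,3) Q(1,3) by (intro form_equivI[of _ "n + m" "P \<oplus>\<^sub>f Q"]) auto
qed


text \<open>The base change is the permutation matrix exchanging the two groups of coordinates; its
  transpose is its inverse.\<close>

lemma direct_sum_commute:
  assumes A: "A \<in> carrier_mat n n" and B: "B \<in> carrier_mat m m"
  shows "A \<oplus>\<^sub>f B \<sim>\<^sub>f B \<oplus>\<^sub>f A"
proof -
  define P :: "real mat" where "P = four_block_mat (0\<^sub>m n m) (1\<^sub>m n) (1\<^sub>m m) (0\<^sub>m m n)"
  define Q :: "real mat" where "Q = four_block_mat (0\<^sub>m m n) (1\<^sub>m m) (1\<^sub>m n) (0\<^sub>m n m)"
  have P: "P \<in> carrier_mat (n + m) (n + m)" and Q: "Q \<in> carrier_mat (n + m) (n + m)"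
    unfolding P_def Q_def by (auto intro!: carrier_matI)
  have one: "four_block_mat (1\<^sub>m i) (0\<^sub>m i j) (0\<^sub>m j i) (1\<^sub>m j) = (1\<^sub>m (i + j) :: real mat)" for i j
    using direct_sum_one[of i j] by (simp add: direct_sum_def)
  have PQ: "P * Q = 1\<^sub>m (n + m)"
    unfolding P_def Q_def
    by (subst mult_four_block_mat[of _ n m _ n _ m _ _ n _ m]) (simp_all add: one)
  have QP: "Q * P = 1\<^sub>m (n + m)"
    by (rule mat_mult_left_right_inverse[OF P Q PQ])
  have PT: "P\<^sup>T = Q"
    unfolding P_def Q_def by (subst transpose_four_block_mat) auto
  have dims: "dim_row A = n" "dim_col A = n" "dim_row B = m" "dim_col B = m"
    using A B by auto
  have "Q * (A \<oplus>\<^sub>f B) = four_block_mat (0\<^sub>m m n) B A (0\<^sub>m n m)"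
    unfolding Q_def direct_sum_def dims
    by (subst mult_four_block_mat[of _ m n _ m _ n _ _ n _ m]) (use A B in simp_all)
  also have "\<dots> * P = B \<oplus>\<^sub>f A"
    unfolding P_def direct_sum_def dims
    by (subst mult_four_block_mat[of _ m n _ m _ n _ _ m _ n]) (use A B in simp_all)
  finally have "B \<oplus>\<^sub>f A = P\<^sup>T * (A \<oplus>\<^sub>f B) * P" unfolding PT ..
  moreover have "invertible_mat P" by (rule invertible_matI[OF P Q PQ QP])
  ultimately show ?thesis
    using A B P by (intro form_equivI[of _ "n + m" P]) (auto simp: add.commute)
qed

subsection \<open>Intersection forms of chains\<close>

lemma intersection_mat_chain_carrier [simp, intro]:
  "intersection_mat (chain ws) \<in> carrier_mat (length ws) (length ws)"
  by (simp add: intersection_mat_def chain_def)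

lemma dim_intersection_mat_chain [simp]:
  "dim_row (intersection_mat (chain ws)) = length ws"
  "dim_col (intersection_mat (chain ws)) = length ws"
  by (simp_all add: intersection_mat_def chain_def)

lemma index_intersection_mat_chain:
  assumes "i < length ws" "j < length ws"
  shows "intersection_mat (chain ws) $$ (i, j) =
    (if i = j then of_int (ws ! i) else if j = Suc i \<or> i = Suc j then 1 else 0)"
  using assms unfolding intersection_mat_def chain_def by (auto simp: doubleton_eq_iff)

lemma form1_carrier [simp, intro]: "form1 a \<in> carrier_mat 1 1"
  by (auto simp: form1_def mat_of_rows_list_def)

lemma dim_form1 [simp]: "dim_row (form1 a) = 1" "dim_col (form1 a) = 1"
  by (simp_all add: form1_def mat_of_rows_list_def)

lemma index_form1 [simp]: "form1 a $$ (0, 0) = a"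
  by (auto simp: form1_def mat_of_rows_list_def)

lemma form2_carrier [simp, intro]: "form2 a b \<in> carrier_mat 2 2"
  by (rule carrier_matI) (simp_all add: form2_def mat_of_rows_list_def)

lemma dim_form2 [simp]: "dim_row (form2 a b) = 2" "dim_col (form2 a b) = 2"
  by (simp_all add: form2_def mat_of_rows_list_def)

lemma index_form2:
  assumes "i < 2" "j < 2"
  shows "form2 a b $$ (i, j) = (if i = j then if i = 0 then a else b else 1)"
  using assms by (auto simp: form2_def mat_of_rows_list_def less_2_cases_iff)

text \<open>Orthogonal sums of one-dimensional forms become \<open>mat_diag\<close>, for which
  products and quadratic values can be computed entrywise.\<close>

lemma diag_block_mat_form1:
  "diag_block_mat (map form1 ds) = mat_diag (length ds) (\<lambda>i. ds ! i)"
proof (induction ds)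
  case (Cons d ds)
  show ?case
  proof (rule eq_matI)
    fix i j
    assume "i < dim_row (mat_diag (length (d # ds)) (\<lambda>i. (d # ds) ! i))"
      "j < dim_col (mat_diag (length (d # ds)) (\<lambda>i. (d # ds) ! i))"
    then show "diag_block_mat (map form1 (d # ds)) $$ (i, j)
      = mat_diag (length (d # ds)) (\<lambda>i. (d # ds) ! i) $$ (i, j)"
      unfolding list.map diag_block_mat_Cons Cons.IH
      by (cases i; cases j) (auto simp: index_direct_sum mat_diag_def)
  qed (simp_all add: diag_block_mat_Cons Cons.IH mat_diag_def del: diag_block_mat.simps)
qed (rule eq_matI; simp add: mat_diag_def)

section \<open>Splitting off pairs of zero vertices\<close>

text \<open>Both v_1 and v_3 meet v_2 once, so v_3 - v_1 is orthogonal to v_2. As v_1 has square 0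
  and meets only v_2, the other products of v_3 do not change. The determinant of \<open>P\<close>
  is recorded for the sake of the discriminant.\<close>

lemma chain_two_zeros:
  obtains P where "P \<in> carrier_mat (length ws + 2) (length ws + 2)" "det P = 1"
    "P\<^sup>T * intersection_mat (chain (0 # 0 # ws)) * P = form2 0 0 \<oplus>\<^sub>f intersection_mat (chain ws)"
proof (cases ws)
  case Nil
  have "intersection_mat (chain [0, 0]) = form2 0 0 \<oplus>\<^sub>f intersection_mat (chain [])"
    by (rule eq_matI)
      (auto simp: index_direct_sum index_intersection_mat_chain index_form2 less_2_cases_iff)
  then show ?thesis
    using Nil by (intro that[of "1\<^sub>m 2"]) (auto simp: carrier_matI)
next
  case (Cons w us)
  let ?A = "intersection_mat (chain (0 # 0 # ws))" and ?n = "length ws + 2"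
  \<comment> \<open>With indices from 0, column 2 of \<open>?P\<close> is e_2 - e_0, the coordinates
    of v_3 - v_1. Multiplying by \<open>?P\<close> and its transpose therefore subtracts column 0
    from column 2 and row 0 from row 2.\<close>
  let ?P = "addrow_mat ?n (- 1 :: real) 0 2"
  have n: "0 < ?n" "2 < ?n" using Cons by auto
  have A: "?A \<in> carrier_mat ?n ?n" by (auto intro!: carrier_matI)
  have "?P\<^sup>T = addrow_mat ?n (- 1) 2 0"
    by (rule eq_matI) auto
  then have "?P\<^sup>T * ?A = addrow (- 1) 2 0 ?A"
    using addrow_mat[OF A n(1)] by metis
  then have "?P\<^sup>T * ?A * ?P = addcol (- 1) 2 0 (addrow (- 1) 2 0 ?A)"
    using addcol_mat[of "addrow (- 1) 2 0 ?A" ?n ?n 0 "- 1" 2] A n by auto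
  also have "\<dots> = form2 0 0 \<oplus>\<^sub>f intersection_mat (chain ws)"
  proof (rule eq_matI)
    fix i j
    assume "i < dim_row (form2 0 0 \<oplus>\<^sub>f intersection_mat (chain ws))"
      "j < dim_col (form2 0 0 \<oplus>\<^sub>f intersection_mat (chain ws))"
    then have ij: "i < ?n" "j < ?n" by auto
    \<comment> \<open>The split and the new basis vector concern only the indices 0, 1, 2; from 3 on
      an entry is that of \<open>chain ws\<close>, shifted by 2.\<close>
    have cases3: "k = 0 \<or> k = 1 \<or> k = 2 \<or> (\<exists>l. k = Suc (Suc (Suc l)))" for k :: nat
      by presburger
    show "addcol (- 1) 2 0 (addrow (- 1) 2 0 ?A) $$ (i, j)
      = (form2 0 0 \<oplus>\<^sub>f intersection_mat (chain ws)) $$ (i, j)"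
      using cases3[of i] cases3[of j] ij Cons
      by (elim disjE exE)
        (simp_all add: index_direct_sum index_intersection_mat_chain index_form2)
  qed auto
  finally show ?thesis
    using det_addrow_mat[of 0 2 ?n "- 1 :: real"] by (intro that[of ?P]) simp_all
qed

lemma chain_two_zeros_equiv:
  "intersection_mat (chain (0 # 0 # ws)) \<sim>\<^sub>f form2 0 0 \<oplus>\<^sub>f intersection_mat (chain ws)"
proof -
  from chain_two_zeros obtain P where P: "P \<in> carrier_mat (length ws + 2) (length ws + 2)"
    "det P = 1"
    "P\<^sup>T * intersection_mat (chain (0 # 0 # ws)) * P = form2 0 0 \<oplus>\<^sub>f intersection_mat (chain ws)" .
  show ?thesis
    by (rule form_equivI[OF _ P(1) invertible_mat_det[OF P(1)] P(3)[symmetric]])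
      (use P(2) in \<open>auto intro!: carrier_matI\<close>)
qed

lemma det_uminus:
  fixes A :: "'a :: comm_ring_1 mat"
  assumes "A \<in> carrier_mat n n"
  shows "det (- A) = (-1) ^ n * det A"
proof -
  have "- A = (-1) \<cdot>\<^sub>m A" by (rule eq_matI) auto
  then show ?thesis using assms det_smult[of "-1" A] by simp
qed

text \<open>Two more vertices leave the sign between det(I) and det(-I) as it is, and the base
  change has determinant 1; the minus sign is the determinant of the summand split off.\<close>

lemma discriminant_two_zeros:
  "discriminant (chain (0 # 0 # ws)) = - discriminant (chain ws)"
proof -
  let ?n = "length ws" and ?A = "intersection_mat (chain (0 # 0 # ws))"
    and ?B = "intersection_mat (chain ws)"
  from chain_two_zeros obtain P where P: "P \<in> carrier_mat (?n + 2) (?n + 2)"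
    "det P = 1" "P\<^sup>T * ?A * P = form2 0 0 \<oplus>\<^sub>f ?B" .
  have A: "?A \<in> carrier_mat (?n + 2) (?n + 2)" by (auto intro!: carrier_matI)
  have "det ?A = det (P\<^sup>T * ?A * P)"
    using P(1,2) A by (simp add: det_mult[of _ "?n + 2"] det_transpose)
  also have "\<dots> = det (form2 0 0) * det ?B"
    unfolding P(3) direct_sum_def by (rule det_four_block_mat_upper_right_zero) auto
  also have "det (form2 0 0) = -1"
  proof -
    have "form2 0 0 = swaprows_mat 2 0 1"
      by (rule eq_matI) (auto simp: index_form2 less_2_cases_iff)
    then show ?thesis by (simp add: det_swaprows_mat)
  qed
  finally show ?thesis
    unfolding discriminant_def det_uminus[OF A] det_uminus[OF intersection_mat_chain_carrier]
    by simp
qed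

lemma discriminant_zeros:
  "discriminant (chain (replicate (2 * k) 0 @ ws)) = (-1) ^ k * discriminant (chain ws)"
  by (induction k) (simp_all add: discriminant_two_zeros)

lemma diag_block_mat_replicate_form2 [simp, intro]:
  "diag_block_mat (replicate k (form2 a b)) \<in> carrier_mat (2 * k) (2 * k)"
  by (rule carrier_matI) (auto simp: dim_diag_block_mat sum_list_replicate)

text \<open>Induction on \<open>k\<close> peels zeros from the front of the chain and so yields the
  summands in this order; \<open>chain_zeros_equiv\<close> exchanges them afterwards.\<close>

lemma chain_zeros_equiv':
  "intersection_mat (chain (replicate (2 * k) 0 @ ws)) \<sim>\<^sub>f
    diag_block_mat (replicate k (form2 0 0)) \<oplus>\<^sub>f intersection_mat (chain ws)"
proof (induction k)
  case 0
  show ?case by (auto intro: form_equiv_refl)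
next
  case (Suc k)
  have "intersection_mat (chain (replicate (2 * Suc k) 0 @ ws)) \<sim>\<^sub>f
    form2 0 0 \<oplus>\<^sub>f intersection_mat (chain (replicate (2 * k) 0 @ ws))"
    using chain_two_zeros_equiv by simp
  also have "\<dots> \<sim>\<^sub>f form2 0 0 \<oplus>\<^sub>f
      (diag_block_mat (replicate k (form2 0 0)) \<oplus>\<^sub>f intersection_mat (chain ws))"
    using Suc.IH by (intro form_equiv_direct_sum form_equiv_refl) auto
  finally show ?case
    unfolding replicate_Suc diag_block_mat_Cons direct_sum_assoc .
qed

lemma chain_zeros_equiv:
  "intersection_mat (chain (replicate (2 * k) 0 @ ws)) \<sim>\<^sub>f
    intersection_mat (chain ws) \<oplus>\<^sub>f diag_block_mat (replicate k (form2 0 0))"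
  by (rule form_equiv_trans[OF chain_zeros_equiv' direct_sum_commute]) auto

lemma intersection_mat_chain_Nil: "intersection_mat (chain []) = 0\<^sub>m 0 0"
  by (rule eq_matI) auto

lemma all_zeros_equiv:
  "intersection_mat (chain (replicate (2 * k) 0)) \<sim>\<^sub>f diag_block_mat (replicate k (form2 0 0))"
  using chain_zeros_equiv[of k "[]"] by (simp add: intersection_mat_chain_Nil)

section \<open>Continued fractions and elimination along a chain\<close>

text \<open>The bound 1 reproduces itself: if the tail c exceeds 1, then 1/c < 1 and k - 1/c > 2 -
  1.\<close>

lemma cont_frac_gt_1:
  assumes "ks \<noteq> []" "\<forall>k \<in> set ks. k \<ge> 2"
  shows "cont_frac ks > 1"
  using assms
proof (induction ks rule: cont_frac.induct)
  case (2 k l ls)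
  then have "cont_frac (l # ls) > 1" "k \<ge> 2" by auto
  then have "1 / cont_frac (l # ls) < 1" by simp
  with \<open>k \<ge> 2\<close> show ?case by (simp only: cont_frac.simps)
qed auto

lemma reduced_weight_neg:
  assumes "\<forall>w \<in> set ws. w \<le> -2" "i < length ws"
  shows "reduced_weight ws i < 0"
proof -
  have "cont_frac (map (\<lambda>w. - of_int w) (drop i ws)) > 1"
    using assms by (intro cont_frac_gt_1) (auto dest!: in_set_dropD)
  then show ?thesis unfolding reduced_weight_def by simp
qed

text \<open>The inner and outer minus signs of the definition cancel, leaving the pivot recursion of
  elimination from the last vertex. The case distinction keeps the unspecified value of
  \<open>cont_frac []\<close> out.\<close>

lemma reduced_weight_rec:
  assumes "i < length ws"
  shows "reduced_weight ws i =
    of_int (ws ! i) - (if Suc i < length ws then 1 / reduced_weight ws (Suc i) else 0)"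
proof (cases "Suc i < length ws")
  case True
  have "drop i ws = ws ! i # ws ! Suc i # drop (Suc (Suc i)) ws"
    "drop (Suc i) ws = ws ! Suc i # drop (Suc (Suc i)) ws"
    using True by (simp_all add: Cons_nth_drop_Suc)
  then show ?thesis using True unfolding reduced_weight_def by simp
next
  case False
  then have "drop i ws = [ws ! i]"
    using assms by (simp add: Cons_nth_drop_Suc[symmetric])
  then show ?thesis using False unfolding reduced_weight_def by simp
qed

text \<open>Elimination from the far end of the chain: \<open>v\<^sub>i = v\<^sub>i' + v\<^sub>i\<^sub>+\<^sub>1' / w\<^sub>i\<^sub>+\<^sub>1'\<close> with pairwise orthogonal
  \<open>v\<^sub>i'\<close> of square \<open>w\<^sub>i'\<close>.\<close>
lemma chain_diagonal:
  assumes nz: "\<And>i. i < length ws \<Longrightarrow> reduced_weight ws i \<noteq> 0"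
  shows "intersection_mat (chain ws) \<sim>\<^sub>f
    diag_block_mat (map (\<lambda>i. form1 (reduced_weight ws i)) [0..<length ws])"
proof -
  let ?n = "length ws" and ?d = "reduced_weight ws" and ?I = "intersection_mat (chain ws)"
  let ?D = "diag_block_mat (map (\<lambda>i. form1 (?d i)) [0..<?n])"
  \<comment> \<open>Column j of \<open>R\<close> holds the coordinates of the old v_j in the new
    basis. Thus \<open>R\<close> expresses the chain through the diagonal form, and the equivalence
    has to be reversed at the end.\<close>
  define r where "r i j = (if i = j then 1 else if i = Suc j then 1 / ?d i else 0)" for i j
  define R where "R = mat ?n ?n (\<lambda>(i, j). r i j)"
  have R: "R \<in> carrier_mat ?n ?n" unfolding R_def by simp
  have "?D = diag_block_mat (map form1 (map ?d [0..<?n]))" by (simp add: comp_def)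
  also have "\<dots> = mat_diag ?n ?d"
    unfolding diag_block_mat_form1 by (rule eq_matI) (auto simp: mat_diag_def)
  finally have D: "?D = mat_diag ?n ?d" .
  have DR: "mat_diag ?n ?d * R = mat ?n ?n (\<lambda>(i, j). ?d i * r i j)"
    unfolding mat_diag_mult_left[OF R] by (rule eq_matI) (auto simp: R_def)
  have "R\<^sup>T * (mat_diag ?n ?d * R) = ?I"
    unfolding DR
  proof (rule eq_matI)
    fix i j assume "i < dim_row ?I" "j < dim_col ?I"
    then have ij: "i < ?n" "j < ?n" by auto
    have "(R\<^sup>T * mat ?n ?n (\<lambda>(i, j). ?d i * r i j)) $$ (i, j) = (\<Sum>k = 0..<?n. r k i * (?d k * r k j))"
      using ij by (simp add: scalar_prod_def R_def)
    \<comment> \<open>Column i of \<open>R\<close> lives in rows i and i+1; in row i+1 the factor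
      1/w' cancels against the diagonal entry w', which is nonzero by \<open>nz\<close>.\<close>
    also have "\<dots> = (\<Sum>k = 0..<?n. (if k = i then ?d i * r i j else 0)
        + (if k = Suc i then r (Suc i) j else 0))"
      using nz by (intro sum.cong) (auto simp: r_def)
    also have "\<dots> = ?d i * r i j + (if Suc i < ?n then r (Suc i) j else 0)"
      using ij by (simp add: sum.distrib sum.delta)
    also have "\<dots> = ?I $$ (i, j)"
    proof (cases "i = j")
      case True
      then show ?thesis
        using ij reduced_weight_rec[of i ws] by (simp add: index_intersection_mat_chain r_def)
    next
      case False
      then show ?thesis
        using ij nz[of i] by (auto simp: index_intersection_mat_chain r_def)
    qed
    finally show "(R\<^sup>T * mat ?n ?n (\<lambda>(i, j). ?d i * r i j)) $$ (i, j) = ?I $$ (i, j)" .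
  qed (simp_all add: R_def)
  then have eq: "?I = R\<^sup>T * ?D * R"
    unfolding D using R assoc_mult_mat[of "R\<^sup>T" ?n ?n "mat_diag ?n ?d" ?n R ?n] by simp
  have "det R = prod_list (diag_mat R)"
    by (rule det_lower_triangular[OF _ R]) (auto simp: R_def r_def)
  also have "diag_mat R = map (\<lambda>i. 1) [0..<?n]"
    unfolding diag_mat_def by (auto simp: R_def r_def)
  also have "prod_list \<dots> = 1" by (simp add: map_replicate_const)
  finally have "invertible_mat R" by (intro invertible_mat_det[OF R]) simp
  moreover have "?D \<in> carrier_mat ?n ?n" unfolding D by simp
  ultimately show ?thesis by (intro form_equiv_sym[OF form_equivI[OF _ R _ eq]])
qed

subsection \<open>Sylvester's law of inertia\<close>

text \<open>Zero rows pad \<open>E\<close> to a square matrix \<open>F\<close>. Row m of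
  \<open>F\<close> vanishes, so e_m lies in the kernel of its transpose; hence det F = 0 and
  \<open>F\<close> has a kernel vector too.\<close>

lemma underdetermined_kernel:
  fixes E :: "'a :: field mat"
  assumes E: "E \<in> carrier_mat m n" and "m < n"
  obtains v where "v \<in> carrier_vec n" "v \<noteq> 0\<^sub>v n" "E *\<^sub>v v = 0\<^sub>v m"
proof -
  define F where "F = mat n n (\<lambda>(i, j). if i < m then E $$ (i, j) else 0)"
  have F: "F \<in> carrier_mat n n" unfolding F_def by simp
  have "det F = det F\<^sup>T" using F by (simp add: det_transpose)
  also have "F\<^sup>T *\<^sub>v unit_vec n m = 0\<^sub>v n"
    using \<open>m < n\<close> by (intro eq_vecI) (auto simp: F_def)
  then have "det F\<^sup>T = 0"
    using \<open>m < n\<close> F by (subst det_0_iff_vec_prod_zero_field[of _ n])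
      (auto intro!: exI[of _ "unit_vec n m"] simp: unit_vec_nonzero)
  finally obtain v where v: "v \<in> carrier_vec n" "v \<noteq> 0\<^sub>v n" "F *\<^sub>v v = 0\<^sub>v n"
    using det_0_iff_vec_prod_zero_field[OF F] by auto
  have "E *\<^sub>v v = 0\<^sub>v m"
  proof (rule eq_vecI)
    fix i assume "i < dim_vec (0\<^sub>v m)"
    then have i: "i < m" by simp
    have "row E i = row F i"
      using i \<open>m < n\<close> E unfolding F_def by (intro eq_vecI) auto
    then have "(E *\<^sub>v v) $ i = (F *\<^sub>v v) $ i"
      using i \<open>m < n\<close> E F by simp
    also have "\<dots> = 0" using v(3) i \<open>m < n\<close> by simp
    finally show "(E *\<^sub>v v) $ i = 0\<^sub>v m $ i" using i by simp
  qed (use E in auto)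
  then show ?thesis using v that by blast
qed

lemma quadratic_mat_diag:
  fixes v :: "'a :: comm_ring_1 vec"
  assumes "v \<in> carrier_vec n"
  shows "v \<bullet> (mat_diag n a *\<^sub>v v) = (\<Sum>i<n. a i * (v $ i)\<^sup>2)"
proof -
  have "(mat_diag n a *\<^sub>v v) $ i = a i * v $ i" if "i < n" for i
  proof -
    have "(mat_diag n a *\<^sub>v v) $ i = (\<Sum>k = 0..<n. (if i = k then a k else 0) * v $ k)"
      using assms that by (auto simp: mat_diag_def scalar_prod_def)
    also have "\<dots> = (\<Sum>k = 0..<n. if k = i then a i * v $ i else 0)"
      by (intro sum.cong) auto
    also have "\<dots> = a i * v $ i" using that by simp
    finally show ?thesis .
  qed
  moreover have "dim_vec (mat_diag n a *\<^sub>v v) = n" by (simp add: mat_diag_def)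
  ultimately show ?thesis
    unfolding scalar_prod_def by (auto simp: lessThan_atLeast0 power2_eq_square ac_simps intro!: sum.cong)
qed

lemma quadratic_congruence:
  fixes D :: "'a :: comm_ring_1 mat"
  assumes D: "D \<in> carrier_mat n n" and P: "P \<in> carrier_mat n n" and v: "v \<in> carrier_vec n"
  shows "v \<bullet> ((P\<^sup>T * D * P) *\<^sub>v v) = (P *\<^sub>v v) \<bullet> (D *\<^sub>v (P *\<^sub>v v))"
proof -
  have "(P\<^sup>T * D * P) *\<^sub>v v = P\<^sup>T *\<^sub>v (D *\<^sub>v (P *\<^sub>v v))"
    using D P v by (simp add: assoc_mult_mat_vec[of _ n n _ n])
  moreover have "v \<bullet> (P\<^sup>T *\<^sub>v (D *\<^sub>v (P *\<^sub>v v))) = (P\<^sup>T *\<^sub>v (D *\<^sub>v (P *\<^sub>v v))) \<bullet> v"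
    using D P v by (intro comm_scalar_prod[of _ n]) auto
  moreover have "\<dots> = (D *\<^sub>v (P *\<^sub>v v)) \<bullet> (P *\<^sub>v v)"
    using D P v by (intro transpose_vec_mult_scalar[of _ n n]) auto
  moreover have "\<dots> = (P *\<^sub>v v) \<bullet> (D *\<^sub>v (P *\<^sub>v v))"
    using D P v by (intro comm_scalar_prod[of _ n]) auto
  ultimately show ?thesis by simp
qed

text \<open>Otherwise some \<open>v \<noteq> 0\<close> is supported where \<open>a > 0\<close> while \<open>P v\<close> vanishes where \<open>b > 0\<close>, and the
  common value of the two forms at \<open>v\<close> is both positive and nonpositive.\<close>
lemma mat_diag_congruence_pos_le:
  fixes P :: "real mat"
  assumes P: "P \<in> carrier_mat n n" and eq: "mat_diag n a = P\<^sup>T * mat_diag n b * P"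
  shows "card {i. i < n \<and> a i > 0} \<le> card {i. i < n \<and> b i > 0}"
proof (rule ccontr)
  assume less: "\<not> ?thesis"
  define xs where "xs = filter (\<lambda>i. \<not> a i > 0) [0..<n]"
  define ys where "ys = filter (\<lambda>i. b i > 0) [0..<n]"
  \<comment> \<open>The rows of \<open>E\<close> are the linear conditions v_i = 0 for i in
    \<open>xs\<close> and (P v)_i = 0 for i in \<open>ys\<close>. If the claim fails, there are
    fewer than n of them.\<close>
  define E where "E = mat_of_rows n (map (unit_vec n) xs @ map (row P) ys)"
  have "length ys = card {i. i < n \<and> b i > 0}"
    unfolding ys_def by (simp add: length_filter_conv_card) (intro arg_cong[of _ _ card], auto)
  moreover have "length (filter (\<lambda>i. a i > 0) [0..<n]) = card {i. i < n \<and> a i > 0}"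
    by (simp add: length_filter_conv_card) (intro arg_cong[of _ _ card], auto)
  moreover have "length (filter (\<lambda>i. a i > 0) [0..<n]) + length xs = n"
    unfolding xs_def using sum_length_filter_compl[of "\<lambda>i. a i > 0" "[0..<n]"] by simp
  ultimately have "length xs + length ys < n" using less by linarith
  moreover have "E \<in> carrier_mat (length xs + length ys) n"
    unfolding E_def using mat_of_rows_carrier(1)[of n "map (unit_vec n) xs @ map (row P) ys"]
    by simp
  ultimately obtain v where v: "v \<in> carrier_vec n" "v \<noteq> 0\<^sub>v n"
    "E *\<^sub>v v = 0\<^sub>v (length xs + length ys)"
    using underdetermined_kernel by metis
  have kernel: "r \<bullet> v = 0" if r: "r \<in> set (map (unit_vec n) xs @ map (row P) ys)" for r
  proof -
    let ?rs = "map (unit_vec n) xs @ map (row P) ys"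
    from r obtain k where k: "k < length ?rs" "r = ?rs ! k" by (metis in_set_conv_nth)
    have "r \<in> carrier_vec n" using r P by auto
    then have "row E k = r"
      unfolding E_def using k by (simp add: mat_of_rows_row)
    moreover have "(E *\<^sub>v v) $ k = row E k \<bullet> v"
      using k unfolding E_def by (intro index_mult_mat_vec) simp
    ultimately show ?thesis using v(3) k(1) by simp
  qed
  have supp: "v $ i = 0" if "i < n" "\<not> a i > 0" for i
    using kernel[of "unit_vec n i"] that v(1) by (simp add: xs_def)
  have vanish: "(P *\<^sub>v v) $ i = 0" if "i < n" "b i > 0" for i
    using kernel[of "row P i"] that P by (simp add: ys_def)
  from v(1,2) obtain i where i: "i < n" "v $ i \<noteq> 0"
    by (metis carrier_vecD eq_vecI index_zero_vec)
  have "0 < a i * (v $ i)\<^sup>2" using supp i by (metis mult_pos_pos zero_less_power2)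
  also have "\<dots> \<le> (\<Sum>i<n. a i * (v $ i)\<^sup>2)"
    using i(1) supp by (intro member_le_sum) (auto, metis less_imp_le mult_eq_0_iff mult_nonneg_nonneg
        not_less power_zero_numeral zero_le_power2)
  also have "\<dots> = v \<bullet> (mat_diag n a *\<^sub>v v)"
    using quadratic_mat_diag[OF v(1)] by metis
  also have "\<dots> = (P *\<^sub>v v) \<bullet> (mat_diag n b *\<^sub>v (P *\<^sub>v v))"
    unfolding eq using P v(1) by (intro quadratic_congruence) auto
  also have "\<dots> = (\<Sum>i<n. b i * ((P *\<^sub>v v) $ i)\<^sup>2)"
    using P v(1) by (intro quadratic_mat_diag) auto
  also have "\<dots> \<le> 0"
  proof (intro sum_nonpos)
    fix i assume "i \<in> {..<n}"
    then show "b i * ((P *\<^sub>v v) $ i)\<^sup>2 \<le> 0"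
      using vanish[of i] by (cases "b i > 0") (auto simp: mult_le_0_iff)
  qed
  finally show False by simp
qed

text \<open>Negating both forms preserves the congruence and turns negative entries into positive
  ones.\<close>

lemma mat_diag_congruence_neg_le:
  fixes P :: "real mat"
  assumes P: "P \<in> carrier_mat n n" and eq: "mat_diag n a = P\<^sup>T * mat_diag n b * P"
  shows "card {i. i < n \<and> a i < 0} \<le> card {i. i < n \<and> b i < 0}"
proof -
  have neg: "mat_diag n (\<lambda>i. - c i) = - mat_diag n c" for c :: "nat \<Rightarrow> real"
    by (rule eq_matI) (auto simp: mat_diag_def)
  have "mat_diag n (\<lambda>i. - a i) = P\<^sup>T * mat_diag n (\<lambda>i. - b i) * P"
  proof -
    have "P\<^sup>T * (- mat_diag n b) * P = (- (P\<^sup>T * mat_diag n b)) * P"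
      using P by (subst uminus_mult_right_mat) (auto simp: mat_diag_def)
    also have "\<dots> = - (P\<^sup>T * mat_diag n b * P)"
      using P by (subst uminus_mult_left_mat) (auto simp: mat_diag_def)
    finally show ?thesis unfolding neg eq ..
  qed
  from mat_diag_congruence_pos_le[OF P this] show ?thesis by simp
qed

text \<open>A single congruence gives one inequality in each sign; invertibility enters through
  \<open>form_equiv_sym\<close>, which supplies the reverse ones.\<close>

lemma sylvester_mat_diag:
  assumes "mat_diag n a \<sim>\<^sub>f mat_diag n b"
  shows "card {i. i < n \<and> a i > 0} = card {i. i < n \<and> b i > 0}"
    and "card {i. i < n \<and> a i < 0} = card {i. i < n \<and> b i < 0}"
proof -
  have *: "\<exists>P \<in> carrier_mat n n. mat_diag n b = P\<^sup>T * mat_diag n a * P"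
    if "mat_diag n a \<sim>\<^sub>f mat_diag n b" for a b
    using that unfolding form_equiv_def by (metis carrier_matD(1) mat_diag_dim)
  from *[OF assms] obtain P where P: "P \<in> carrier_mat n n" "mat_diag n b = P\<^sup>T * mat_diag n a * P"
    by blast
  from *[OF form_equiv_sym[OF assms]] obtain Q where
    Q: "Q \<in> carrier_mat n n" "mat_diag n a = Q\<^sup>T * mat_diag n b * Q"
    by blast
  show "card {i. i < n \<and> a i > 0} = card {i. i < n \<and> b i > 0}"
    by (rule order_antisym[OF mat_diag_congruence_pos_le[OF Q] mat_diag_congruence_pos_le[OF P]])
  show "card {i. i < n \<and> a i < 0} = card {i. i < n \<and> b i < 0}"
    by (rule order_antisym[OF mat_diag_congruence_neg_le[OF Q] mat_diag_congruence_neg_le[OF P]])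
qed

subsection \<open>The spectral theorem for real symmetric matrices\<close>

lemma scalar_prod_self_ge_0: "v \<bullet> v \<ge> (0 :: real)"
  by (simp add: scalar_prod_def sum_nonneg)

lemma scalar_prod_self_eq_0_iff:
  fixes v :: "real vec"
  assumes "v \<in> carrier_vec n"
  shows "v \<bullet> v = 0 \<longleftrightarrow> v = 0\<^sub>v n"
proof
  assume "v \<bullet> v = 0"
  then have "\<forall>i\<in>{0..<n}. v $ i * v $ i = 0"
    using assms unfolding scalar_prod_def by (subst (asm) sum_nonneg_eq_0_iff) auto
  then show "v = 0\<^sub>v n" using assms by (intro eq_vecI) auto
qed simp

text \<open>For a complex eigenvector \<open>x + i y\<close> with eigenvalue \<open>a + i b\<close>, comparing \<open>y \<bullet> A x\<close> with
  \<open>x \<bullet> A y\<close> gives \<open>b (x \<bullet> x + y \<bullet> y) = 0\<close>.\<close>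
lemma symmetric_real_eigenvector:
  fixes A :: "real mat"
  assumes A: "A \<in> carrier_mat n n" and sym: "A\<^sup>T = A" and n: "n > 0"
  obtains v e where "v \<in> carrier_vec n" "v \<noteq> 0\<^sub>v n" "A *\<^sub>v v = e \<cdot>\<^sub>v v"
proof -
  \<comment> \<open>Over the complex numbers a matrix of positive size has an eigenvalue; its
    eigenvector is then split into real and imaginary parts.\<close>
  let ?B = "map_mat complex_of_real A"
  have B: "?B \<in> carrier_mat n n" using A by simp
  from spectrum_non_empty[OF B n] obtain k where "eigenvalue ?B k"
    unfolding spectrum_def by auto
  then obtain w where w: "w \<in> carrier_vec n" "w \<noteq> 0\<^sub>v n" "?B *\<^sub>v w = k \<cdot>\<^sub>v w"
    using A unfolding eigenvalue_def eigenvector_def by auto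
  define x where "x = map_vec Re w"
  define y where "y = map_vec Im w"
  have x: "x \<in> carrier_vec n" and y: "y \<in> carrier_vec n" using w(1) unfolding x_def y_def by auto
  have ev: "(\<Sum>j = 0..<n. complex_of_real (A $$ (i, j)) * w $ j) = k * w $ i" if "i < n" for i
  proof -
    have "(?B *\<^sub>v w) $ i = (\<Sum>j = 0..<n. complex_of_real (A $$ (i, j)) * w $ j)"
      using that w(1) A by (auto simp: scalar_prod_def)
    then show ?thesis using w(1,3) that by simp
  qed
  have Ax: "A *\<^sub>v x = Re k \<cdot>\<^sub>v x - Im k \<cdot>\<^sub>v y"
  proof (rule eq_vecI)
    fix i assume "i < dim_vec (Re k \<cdot>\<^sub>v x - Im k \<cdot>\<^sub>v y)"
    then have i: "i < n" using y by simp
    have "(A *\<^sub>v x) $ i = (\<Sum>j = 0..<n. A $$ (i, j) * Re (w $ j))"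
      using i A w(1) by (auto simp: scalar_prod_def x_def)
    also have "\<dots> = Re (k * w $ i)" unfolding ev[OF i, symmetric] by simp
    finally show "(A *\<^sub>v x) $ i = (Re k \<cdot>\<^sub>v x - Im k \<cdot>\<^sub>v y) $ i"
      using i w(1) by (simp add: x_def y_def)
  qed (use A y in auto)
  have Ay: "A *\<^sub>v y = Im k \<cdot>\<^sub>v x + Re k \<cdot>\<^sub>v y"
  proof (rule eq_vecI)
    fix i assume "i < dim_vec (Im k \<cdot>\<^sub>v x + Re k \<cdot>\<^sub>v y)"
    then have i: "i < n" using y by simp
    have "(A *\<^sub>v y) $ i = (\<Sum>j = 0..<n. A $$ (i, j) * Im (w $ j))"
      using i A w(1) by (auto simp: scalar_prod_def y_def)
    also have "\<dots> = Im (k * w $ i)" unfolding ev[OF i, symmetric] by simp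
    finally show "(A *\<^sub>v y) $ i = (Im k \<cdot>\<^sub>v x + Re k \<cdot>\<^sub>v y) $ i"
      using i w(1) by (simp add: x_def y_def)
  qed (use A y in auto)
  have xy: "x \<bullet> y = y \<bullet> x" by (rule comm_scalar_prod[OF x y])
  have "y \<bullet> (A *\<^sub>v x) = (A *\<^sub>v y) \<bullet> x"
    using transpose_vec_mult_scalar[OF A x y] unfolding sym by simp
  moreover have "y \<bullet> (A *\<^sub>v x) = Re k * (y \<bullet> x) - Im k * (y \<bullet> y)"
    unfolding Ax using x y by (simp add: scalar_prod_minus_distrib[of _ n])
  moreover have "(A *\<^sub>v y) \<bullet> x = Im k * (x \<bullet> x) + Re k * (y \<bullet> x)"
    unfolding Ay using x y by (simp add: add_scalar_prod_distrib[of _ n])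
  ultimately have "Im k * (x \<bullet> x + y \<bullet> y) = 0" by (simp add: algebra_simps)
  moreover have "x \<noteq> 0\<^sub>v n \<or> y \<noteq> 0\<^sub>v n"
  proof (rule ccontr)
    assume "\<not> ?thesis"
    then have "map_vec Re w $ i = 0\<^sub>v n $ i \<and> map_vec Im w $ i = 0\<^sub>v n $ i" for i
      unfolding x_def y_def by simp
    then have "w $ i = 0" if "i < n" for i
      using that w(1) by (metis carrier_vecD complex_eq_iff index_map_vec(1) index_zero_vec(1) zero_complex.sel)
    with w(1,2) show False by (metis carrier_vecD eq_vecI index_zero_vec)
  qed
  moreover from this have "x \<bullet> x + y \<bullet> y \<noteq> 0"
    using scalar_prod_self_ge_0[of x] scalar_prod_self_ge_0[of y]
      scalar_prod_self_eq_0_iff[OF x] scalar_prod_self_eq_0_iff[OF y] by auto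
  ultimately have "Im k = 0" by simp
  then have "A *\<^sub>v x = Re k \<cdot>\<^sub>v x" "A *\<^sub>v y = Re k \<cdot>\<^sub>v y"
    unfolding Ax Ay using x y by (auto intro!: eq_vecI)
  \<comment> \<open>Which of the two parts is nonzero is not known, but either one serves as a real
    eigenvector.\<close>
  with \<open>x \<noteq> 0\<^sub>v n \<or> y \<noteq> 0\<^sub>v n\<close> show ?thesis using that x y by blast
qed

lemma unit_eigenvector:
  fixes A :: "real mat"
  assumes A: "A \<in> carrier_mat n n" and "A\<^sup>T = A" and "n > 0"
  obtains v e where "v \<in> carrier_vec n" "v \<bullet> v = 1" "A *\<^sub>v v = e \<cdot>\<^sub>v v"
proof -
  from symmetric_real_eigenvector[OF assms] obtain v e where
    v: "v \<in> carrier_vec n" "v \<noteq> 0\<^sub>v n" "A *\<^sub>v v = e \<cdot>\<^sub>v v" .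
  define c where "c = 1 / sqrt (v \<bullet> v)"
  have "v \<bullet> v > 0"
    using scalar_prod_self_eq_0_iff[OF v(1)] v(2) scalar_prod_self_ge_0[of v] by simp
  then have "c * (c * (v \<bullet> v)) = 1" unfolding c_def by simp
  then have "(c \<cdot>\<^sub>v v) \<bullet> (c \<cdot>\<^sub>v v) = 1" using v(1) by simp
  moreover have "A *\<^sub>v (c \<cdot>\<^sub>v v) = e \<cdot>\<^sub>v (c \<cdot>\<^sub>v v)"
    using v(1,3) A by (simp add: mult_mat_vec[of _ n n] smult_smult_assoc mult.commute)
  ultimately show ?thesis using v(1) by (intro that[of "c \<cdot>\<^sub>v v"]) auto
qed

text \<open>The reflection in the hyperplane orthogonal to \<open>v - e\<^sub>0\<close>. For \<open>v = e\<^sub>0\<close> the factor \<open>2 / 0 = 0\<close>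
  makes \<open>Q\<close> the identity.\<close>
lemma householder:
  fixes v :: "real vec"
  assumes v: "v \<in> carrier_vec n" "v \<bullet> v = 1" and n: "n > 0"
  obtains Q where "Q \<in> carrier_mat n n" "Q\<^sup>T = Q" "Q * Q = 1\<^sub>m n" "Q *\<^sub>v v = unit_vec n 0"
proof -
  define u where "u i = v $ i - (if i = 0 then 1 else 0)" for i
  define s where "s = (\<Sum>k = 0..<n. u k * u k)"
  define c where "c = 2 / s"
  define q where "q i j = (if i = j then 1 else 0) - c * u i * u j" for i j
  define Q where "Q = mat n n (\<lambda>(i, j). q i j)"
  have Q: "Q \<in> carrier_mat n n" unfolding Q_def by simp
  have vv: "(\<Sum>k = 0..<n. v $ k * v $ k) = 1" using v unfolding scalar_prod_def by simp
  have uv: "(\<Sum>k = 0..<n. u k * v $ k) = 1 - v $ 0"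
  proof -
    have "(\<Sum>k = 0..<n. u k * v $ k)
      = (\<Sum>k = 0..<n. v $ k * v $ k - (if k = 0 then v $ k else 0))"
      by (intro sum.cong) (auto simp: u_def algebra_simps)
    then show ?thesis using vv n by (simp add: sum_subtractf)
  qed
  \<comment> \<open>Since v and e_0 are unit vectors, the squared length of u = v - e_0 is 2(1 -
    v_0), twice the product of u and v. Hence c times that product is 1 and Q v = v - u =
    e_0.\<close>
  have "s = (\<Sum>k = 0..<n. u k * v $ k - (if k = 0 then u k else 0))"
    unfolding s_def by (intro sum.cong) (auto simp: u_def algebra_simps)
  also have "\<dots> = 2 * (1 - v $ 0)"
    using uv n by (simp add: sum_subtractf u_def)
  finally have s: "s = 2 * (1 - v $ 0)" .
  \<comment> \<open>For v = e_0 one has c = 0, so c (1 - v_0) = 1 fails; there v - u = v must come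
    from u = 0.\<close>
  have u0: "u i = 0" if "s = 0" "i < n" for i
    using that sum_nonneg_eq_0_iff[of "{0..<n}" "\<lambda>k. u k * u k"] unfolding s_def by auto
  have "Q\<^sup>T = Q" unfolding Q_def q_def by (rule eq_matI) auto
  moreover have "Q * Q = 1\<^sub>m n"
  proof (rule eq_matI)
    fix i j assume "i < dim_row (1\<^sub>m n :: real mat)" "j < dim_col (1\<^sub>m n :: real mat)"
    then have ij: "i < n" "j < n" by auto
    have "(Q * Q) $$ (i, j) = (\<Sum>k = 0..<n. q i k * q k j)"
      using ij unfolding Q_def by (simp add: scalar_prod_def)
    also have "\<dots> = (\<Sum>k = 0..<n. (if k = i then q k j else 0) - c * u i * (if k = j then u k else 0)
        + c * u i * (c * u j) * (u k * u k))"
      by (intro sum.cong) (auto simp: q_def algebra_simps)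
    also have "\<dots> = q i j - c * u i * u j + c * u i * (c * u j) * s"
      using ij unfolding s_def by (simp add: sum.distrib sum_subtractf sum_distrib_left[symmetric])
    \<comment> \<open>All terms in u cancel: c s = 2 if s is nonzero, and otherwise c = 0.\<close>
    also have "\<dots> = (1\<^sub>m n :: real mat) $$ (i, j)"
      using ij by (cases "s = 0") (auto simp: q_def c_def field_simps)
    finally show "(Q * Q) $$ (i, j) = (1\<^sub>m n :: real mat) $$ (i, j)" .
  qed (use Q in auto)
  moreover have "Q *\<^sub>v v = unit_vec n 0"
  proof (rule eq_vecI)
    fix i assume "i < dim_vec (unit_vec n 0 :: real vec)"
    then have i: "i < n" by simp
    have "(Q *\<^sub>v v) $ i = (\<Sum>k = 0..<n. q i k * v $ k)"
      using i v(1) unfolding Q_def by (simp add: scalar_prod_def)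
    also have "\<dots> = (\<Sum>k = 0..<n. (if k = i then v $ k else 0) - c * u i * (u k * v $ k))"
      by (intro sum.cong) (auto simp: q_def algebra_simps)
    also have "\<dots> = v $ i - c * u i * (1 - v $ 0)"
      using i by (simp add: sum_subtractf sum_distrib_left[symmetric] uv)
    also have "\<dots> = v $ i - u i"
    proof (cases "s = 0")
      case False
      then have "c * (1 - v $ 0) = 1" unfolding c_def using s by simp
      then show ?thesis by (metis mult.assoc mult.commute mult_1)
    qed (use u0 i in simp)
    also have "\<dots> = unit_vec n 0 $ i" using i n by (simp add: u_def)
    finally show "(Q *\<^sub>v v) $ i = unit_vec n 0 $ i" .
  qed (use Q in auto)
  ultimately show ?thesis using Q that by blast
qed

text \<open>Deflation: a reflection moves a unit eigenvector to e_0, so the transformed matrix has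
  first column e e_0 and, being symmetric, first row likewise. The remaining block is symmetric and
  falls under the induction hypothesis.\<close>

theorem real_spectral_theorem:
  fixes A :: "real mat"
  assumes "A \<in> carrier_mat n n" "A\<^sup>T = A"
  shows "\<exists>P \<in> carrier_mat n n. \<exists>ds. length ds = n \<and> P\<^sup>T * P = 1\<^sub>m n
    \<and> P\<^sup>T * A * P = diag_block_mat (map form1 ds)"
  using assms
proof (induction n arbitrary: A)
  case 0
  then show ?case by (intro bexI[of _ "1\<^sub>m 0"] exI[of _ "[]"]) auto
next
  case (Suc n)
  note A = Suc.prems
  from unit_eigenvector[OF A] obtain v e where
    v: "v \<in> carrier_vec (Suc n)" "v \<bullet> v = 1" "A *\<^sub>v v = e \<cdot>\<^sub>v v" by auto
  from householder[OF v(1,2)] obtain Q where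
    Q: "Q \<in> carrier_mat (Suc n) (Suc n)" "Q\<^sup>T = Q" "Q * Q = 1\<^sub>m (Suc n)"
    "Q *\<^sub>v v = unit_vec (Suc n) 0" by auto
  define B where "B = Q\<^sup>T * A * Q"
  have B: "B \<in> carrier_mat (Suc n) (Suc n)" unfolding B_def using A Q by auto
  have Bsym: "B\<^sup>T = B"
  proof -
    have "B\<^sup>T = Q\<^sup>T * (Q\<^sup>T * A)\<^sup>T"
      unfolding B_def using A Q by (intro transpose_mult) auto
    also have "(Q\<^sup>T * A)\<^sup>T = A\<^sup>T * Q\<^sup>T\<^sup>T"
      using A Q by (intro transpose_mult) auto
    finally show ?thesis
      unfolding B_def A(2) transpose_transpose
      using A(1) Q(1) assoc_mult_mat[of "Q\<^sup>T" "Suc n" "Suc n" A "Suc n" Q "Suc n"] by simp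
  qed
  \<comment> \<open>\<open>Q\<close> is an involution, so it also carries e_0 back to v.\<close>
  have Qe: "Q *\<^sub>v unit_vec (Suc n) 0 = v"
    using assoc_mult_mat_vec[OF Q(1) Q(1) v(1)] v(1) unfolding Q(3,4) by simp
  have "B *\<^sub>v unit_vec (Suc n) 0 = Q *\<^sub>v (A *\<^sub>v (Q *\<^sub>v unit_vec (Suc n) 0))"
    unfolding B_def Q(2) using A(1) Q(1) by (simp add: assoc_mult_mat_vec[of _ "Suc n" "Suc n" _ "Suc n"])
  also have "\<dots> = e \<cdot>\<^sub>v unit_vec (Suc n) 0"
    unfolding Qe v(3) mult_mat_vec[OF Q(1) v(1)] Q(4) ..
  finally have Be: "B *\<^sub>v unit_vec (Suc n) 0 = e \<cdot>\<^sub>v unit_vec (Suc n) 0" .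
  have col0: "B $$ (i, 0) = (if i = 0 then e else 0)" if "i < Suc n" for i
  proof -
    have "B $$ (i, 0) = row B i \<bullet> unit_vec (Suc n) 0"
      using that B by (subst scalar_prod_right_unit[of _ "Suc n"]) auto
    also have "\<dots> = (B *\<^sub>v unit_vec (Suc n) 0) $ i" using that B by simp
    finally show ?thesis unfolding Be using that by simp
  qed
  have row0: "B $$ (0, i) = (if i = 0 then e else 0)" if "i < Suc n" for i
    using col0[OF that] Bsym B that by (metis carrier_matD index_transpose_mat(1) zero_less_Suc)
  define B' where "B' = mat n n (\<lambda>(i, j). B $$ (Suc i, Suc j))"
  have B': "B' \<in> carrier_mat n n" unfolding B'_def by simp
  have "B'\<^sup>T = B'"
  proof (rule eq_matI)
    fix i j assume "i < dim_row B'" "j < dim_col B'"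
    then show "B'\<^sup>T $$ (i, j) = B' $$ (i, j)"
      using arg_cong[OF Bsym, of "\<lambda>M. M $$ (Suc i, Suc j)"] B unfolding B'_def by simp
  qed (simp_all add: B'_def)
  from Suc.IH[OF B' this] obtain R ds where R: "R \<in> carrier_mat n n" "length ds = n"
    "R\<^sup>T * R = 1\<^sub>m n" "R\<^sup>T * B' * R = diag_block_mat (map form1 ds)" by blast
  have Bsum: "B = form1 e \<oplus>\<^sub>f B'"
  proof (rule eq_matI)
    fix i j assume "i < dim_row (form1 e \<oplus>\<^sub>f B')" "j < dim_col (form1 e \<oplus>\<^sub>f B')"
    then show "B $$ (i, j) = (form1 e \<oplus>\<^sub>f B') $$ (i, j)"
      using row0 col0 by (cases i; cases j) (auto simp: index_direct_sum B'_def)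
  qed (use B in \<open>auto simp: B'_def\<close>)
  let ?S = "1\<^sub>m 1 \<oplus>\<^sub>f R"
  have S: "?S \<in> carrier_mat (Suc n) (Suc n)" using R(1) by (auto intro!: carrier_matI)
  have "(Q * ?S)\<^sup>T * A * (Q * ?S) = ?S\<^sup>T * B * ?S"
    unfolding B_def by (rule congruence_mult[OF A(1) Q(1) S, symmetric])
  also have "\<dots> = (1\<^sub>m 1)\<^sup>T * form1 e * 1\<^sub>m 1 \<oplus>\<^sub>f R\<^sup>T * B' * R"
    unfolding Bsum by (rule direct_sum_congruence) (use B' R(1) in auto)
  also have "(1\<^sub>m 1)\<^sup>T * form1 e * 1\<^sub>m 1 = form1 e"
    using form1_carrier[of e] by simp
  also have "form1 e \<oplus>\<^sub>f R\<^sup>T * B' * R = diag_block_mat (map form1 (e # ds))"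
    unfolding R(4) list.map diag_block_mat_Cons ..
  finally have diag: "(Q * ?S)\<^sup>T * A * (Q * ?S) = diag_block_mat (map form1 (e # ds))" .
  have "(Q * ?S)\<^sup>T * (Q * ?S) = (?S\<^sup>T * Q\<^sup>T) * (Q * ?S)"
    using transpose_mult[OF Q(1) S] by simp
  also have "\<dots> = ?S\<^sup>T * (Q * (Q * ?S))"
    unfolding Q(2) using Q(1) S by (intro assoc_mult_mat) auto
  also have "Q * (Q * ?S) = ?S"
    unfolding assoc_mult_mat[OF Q(1) Q(1) S, symmetric] Q(3) by (rule left_mult_one_mat[OF S])
  also have "?S\<^sup>T * ?S = 1\<^sub>m 1 \<oplus>\<^sub>f 1\<^sub>m n"
    unfolding direct_sum_transpose using R(1,3)
    by (subst direct_sum_mult[of _ 1 _ n]) auto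
  also have "\<dots> = 1\<^sub>m (Suc n)" unfolding direct_sum_one by simp
  finally show ?case
    using diag R(2) Q(1) S by (intro bexI[of _ "Q * ?S"] exI[of _ "e # ds"]) auto
qed

subsection \<open>Inertia of a diagonalised form\<close>

text \<open>For orthogonal \<open>P\<close> the transpose is the inverse, so this congruence keeps
  the characteristic polynomial.\<close>

lemma orthogonal_congruence_imp_similar:
  fixes A :: "'a :: field mat"
  assumes A: "A \<in> carrier_mat n n" and P: "P \<in> carrier_mat n n" and orth: "P\<^sup>T * P = 1\<^sub>m n"
  shows "similar_mat A (P\<^sup>T * A * P)"
proof -
  have PT: "P\<^sup>T \<in> carrier_mat n n" using P by simp
  have orth': "P * P\<^sup>T = 1\<^sub>m n"
    by (rule mat_mult_left_right_inverse[OF PT P orth])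
  have "P * (P\<^sup>T * A * P) * P\<^sup>T = (P * P\<^sup>T) * A * (P * P\<^sup>T)"
    using A P by (simp add: assoc_mult_mat[of _ n n _ n _ n])
  then have "A = P * (P\<^sup>T * A * P) * P\<^sup>T" unfolding orth' using A by simp
  then have "similar_mat_wit A (P\<^sup>T * A * P) P P\<^sup>T"
    by (rule similar_mat_witI[OF orth' orth]) (use A P in auto)
  then show ?thesis unfolding similar_mat_def by blast
qed

lemma char_poly_diag_form:
  "char_poly (diag_block_mat (map form1 ds)) = (\<Prod>a\<leftarrow>ds. [:- a, 1:])"
proof -
  let ?D = "mat_diag (length ds) (\<lambda>i. ds ! i)"
  have "diag_mat ?D = ds"
    unfolding diag_mat_def by (intro nth_equalityI) (auto simp: mat_diag_def)
  moreover have "char_poly ?D = (\<Prod>a\<leftarrow>diag_mat ?D. [:- a, 1:])"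
    by (rule char_poly_upper_triangular[of _ "length ds"]) (auto simp: mat_diag_def)
  ultimately show ?thesis unfolding diag_block_mat_form1 by simp
qed

lemma order_prod_linear: "order x (\<Prod>a\<leftarrow>ds. [:- a, 1:]) = count_list ds x"
  for x :: "'a :: idom"
proof (induction ds)
  case (Cons d ds)
  have "(\<Prod>a\<leftarrow>d # ds. [:- a, 1:]) \<noteq> 0"
    by (auto simp: prod_list_zero_iff simp del: prod_list.Cons mult_pCons_left)
  then have "order x (\<Prod>a\<leftarrow>d # ds. [:- a, 1:])
    = order x [:- d, 1:] + order x (\<Prod>a\<leftarrow>ds. [:- a, 1:])"
    unfolding list.map prod_list.Cons by (rule order_mult)
  then show ?case using Cons.IH by (auto simp: order_linear')
qed simp

lemma sum_count_list_filter:
  "(\<Sum>x | x \<in> set ds \<and> p x. count_list ds x) = length (filter p ds)"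
proof -
  have "count_list ds x = count_list (filter p ds) x" if "p x" for x
    using that by (induction ds) auto
  then have "(\<Sum>x | x \<in> set ds \<and> p x. count_list ds x)
    = sum (count_list (filter p ds)) (set (filter p ds))"
    by (intro sum.cong) auto
  then show ?thesis by (simp add: sum_count_set)
qed

text \<open>The predicate \<open>p\<close> lets one lemma serve all three inertia indices.\<close>

lemma eigenvalue_count:
  fixes A :: "real mat"
  assumes A: "A \<in> carrier_mat n n" and cp: "char_poly A = (\<Prod>a\<leftarrow>ds. [:- a, 1:])"
  shows "(\<Sum>x | eigenvalue A x \<and> p x. order x (char_poly A)) = length (filter p ds)"
proof -
  have "eigenvalue A x \<longleftrightarrow> x \<in> set ds" for x
    unfolding eigenvalue_root_char_poly[OF A] cp by (induction ds) auto
  then show ?thesis unfolding cp order_prod_linear by (simp add: sum_count_list_filter)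
qed

text \<open>The entries of \<open>ds\<close> need not be eigenvalues of \<open>A\<close>. The
  eigenvalues are the list \<open>es\<close> from the spectral theorem, and only the numbers of
  entries of each sign agree.\<close>

theorem inertia_diag_form:
  assumes equiv: "A \<sim>\<^sub>f diag_block_mat (map form1 ds)"
  shows "inertia A = (length (filter (\<lambda>x. x > 0) ds), length (filter (\<lambda>x. x < 0) ds),
    length (filter (\<lambda>x. x = 0) ds))"
proof -
  let ?n = "length ds"
  let ?D = "mat_diag ?n (\<lambda>i. ds ! i)"
  from form_equiv_sym[OF equiv] obtain m P where *: "?D \<in> carrier_mat m m"
    "A \<in> carrier_mat m m" "P \<in> carrier_mat m m" "A = P\<^sup>T * ?D * P"
    unfolding diag_block_mat_form1 by (elim form_equivE) blast
  have m: "m = ?n" using *(1) by (auto simp: mat_diag_def)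
  have A: "A \<in> carrier_mat ?n ?n" and P: "P \<in> carrier_mat ?n ?n" using *(2,3) unfolding m by auto
  have Dsym: "?D\<^sup>T = ?D" by (rule eq_matI) (auto simp: mat_diag_def)
  have "A\<^sup>T = P\<^sup>T * (P\<^sup>T * ?D)\<^sup>T"
    unfolding *(4) using P by (intro transpose_mult[of _ ?n ?n _ ?n]) auto
  also have "(P\<^sup>T * ?D)\<^sup>T = ?D\<^sup>T * P\<^sup>T\<^sup>T"
    using P by (intro transpose_mult[of _ ?n ?n _ ?n]) auto
  also have "P\<^sup>T * (?D\<^sup>T * P\<^sup>T\<^sup>T) = A"
    unfolding Dsym transpose_transpose *(4)
    using P by (intro assoc_mult_mat[of _ ?n ?n _ ?n _ ?n, symmetric]) auto
  finally have sym: "A\<^sup>T = A" .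
  from real_spectral_theorem[OF A sym] obtain Q es where Q: "Q \<in> carrier_mat ?n ?n"
    "length es = ?n" "Q\<^sup>T * Q = 1\<^sub>m ?n" "Q\<^sup>T * A * Q = diag_block_mat (map form1 es)" by blast
  have "Q * Q\<^sup>T = 1\<^sub>m ?n"
    by (rule mat_mult_left_right_inverse[OF _ Q(1,3)]) (use Q(1) in simp)
  then have "invertible_mat Q"
    using Q(1,3) by (intro invertible_matI[of _ ?n "Q\<^sup>T"]) auto
  then have "A \<sim>\<^sub>f diag_block_mat (map form1 es)"
    by (rule form_equivI[OF A Q(1) _ Q(4)[symmetric]])
  from form_equiv_trans[OF form_equiv_sym[OF this] equiv]
  have equiv': "mat_diag ?n (\<lambda>i. es ! i) \<sim>\<^sub>f mat_diag ?n (\<lambda>i. ds ! i)"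
    unfolding diag_block_mat_form1 Q(2) .
  have pos: "length (filter (\<lambda>x. x > 0) es) = length (filter (\<lambda>x. x > 0) ds)"
    and neg: "length (filter (\<lambda>x. x < 0) es) = length (filter (\<lambda>x. x < 0) ds)"
    using sylvester_mat_diag[OF equiv'] Q(2) by (simp_all add: length_filter_conv_card)
  have split: "length xs = length (filter (\<lambda>x. x > 0) xs) + length (filter (\<lambda>x. x < 0) xs)
    + length (filter (\<lambda>x. x = 0) xs)" for xs :: "real list"
    by (induction xs) auto
  \<comment> \<open>Sylvester's law was proved for the two strict signs; the zeros are what remains,
    since both lists have the same length.\<close>
  have null: "length (filter (\<lambda>x. x = 0) es) = length (filter (\<lambda>x. x = 0) ds)"
    using split[of es] split[of ds] pos neg Q(2) by simp
  have "char_poly A = (\<Prod>a\<leftarrow>es. [:- a, 1:])"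
    using char_poly_similar[OF orthogonal_congruence_imp_similar[OF A Q(1,3)]]
    unfolding Q(4) char_poly_diag_form .
  note count = eigenvalue_count[OF A this]
  show ?thesis
    unfolding inertia_def pos_index_def neg_index_def null_index_def count pos neg null ..
qed

subsection \<open>Inertia of chains\<close>

text \<open>The vectors e_0 + e_1 and e_0 - e_1 are orthogonal for this form and have squares 2 and
  -2. The matrix \<open>P\<close> with these columns satisfies P P = 2, so its inverse is
  P/2.\<close>

lemma form2_zero_diagonal: "form2 0 0 \<sim>\<^sub>f diag_block_mat (map form1 [2, -2])"
proof -
  define P :: "real mat" where "P = mat 2 2 (\<lambda>(i, j). if i = 1 \<and> j = 1 then -1 else 1)"
  have P: "P \<in> carrier_mat 2 2" unfolding P_def by simp
  have PP: "P * (1 / 2 \<cdot>\<^sub>m P) = 1\<^sub>m 2"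
    by (rule eq_matI) (auto simp: P_def scalar_prod_def less_Suc_eq numeral_2_eq_2)
  have inv: "invertible_mat P"
    by (rule invertible_matI[OF P _ PP mat_mult_left_right_inverse[OF P _ PP]]) (use P in auto)
  have "diag_block_mat (map form1 [2, -2]) = P\<^sup>T * form2 0 0 * P"
    unfolding diag_block_mat_form1
    by (rule eq_matI)
      (auto simp: P_def mat_diag_def scalar_prod_def less_Suc_eq numeral_2_eq_2 index_form2)
  then show ?thesis by (rule form_equivI[OF form2_carrier P inv])
qed

lemma hyperbolic_sum_diagonal:
  "diag_block_mat (replicate k (form2 0 0)) \<sim>\<^sub>f
    diag_block_mat (map form1 (concat (replicate k [2, -2])))"
proof (induction k)
  case (Suc k)
  show ?case
    unfolding replicate_Suc diag_block_mat_Cons concat.simps map_append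
      diag_block_mat_append_direct_sum
    by (rule form_equiv_direct_sum[OF form2_zero_diagonal Suc.IH])
qed (simp add: form_equiv_refl[of _ 0])

text \<open>Common source of all the index computations: it is applied with \<open>ds\<close> equal
  to \<open>[]\<close>, to \<open>[0]\<close> and to the list of reduced weights.\<close>

lemma inertia_chain_zeros:
  assumes "intersection_mat (chain ws) \<sim>\<^sub>f diag_block_mat (map form1 ds)"
  shows "inertia (intersection_mat (chain (replicate (2 * k) 0 @ ws))) =
    (length (filter (\<lambda>x. x > 0) ds) + k, length (filter (\<lambda>x. x < 0) ds) + k,
     length (filter (\<lambda>x. x = 0) ds))"
proof -
  have "intersection_mat (chain (replicate (2 * k) 0 @ ws)) \<sim>\<^sub>f
    intersection_mat (chain ws) \<oplus>\<^sub>f diag_block_mat (replicate k (form2 0 0))"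
    by (rule chain_zeros_equiv)
  also have "\<dots> \<sim>\<^sub>f diag_block_mat (map form1 (ds @ concat (replicate k [2, -2])))"
    unfolding map_append diag_block_mat_append_direct_sum
    by (rule form_equiv_direct_sum[OF assms hyperbolic_sum_diagonal])
  finally have *: "intersection_mat (chain (replicate (2 * k) 0 @ ws)) \<sim>\<^sub>f
    diag_block_mat (map form1 (ds @ concat (replicate k [2, -2])))" .
  have "length (filter (\<lambda>x. x > 0) (concat (replicate k [2, -2 :: real]))) = k"
    "length (filter (\<lambda>x. x < 0) (concat (replicate k [2, -2 :: real]))) = k"
    "length (filter (\<lambda>x. x = 0) (concat (replicate k [2, -2 :: real]))) = 0"
    by (induction k) auto
  then show ?thesis unfolding inertia_diag_form[OF *] filter_append length_append by simp
qed

lemma inertia_even_zeros: "inertia (intersection_mat (chain (replicate (2 * k) 0))) = (k, k, 0)"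
  using inertia_chain_zeros[of "[]" "[]" k]
  by (simp add: intersection_mat_chain_Nil form_equiv_refl[of _ 0])

text \<open>Moves the unpaired zero to the end, where it forms the residual chain \<open>[0]\<close>
  and accounts for the zero eigenvalue.\<close>

lemma replicate_odd: "replicate (2 * k + 1) x = replicate (2 * k) x @ [x]"
  by (simp add: replicate_append_same)

lemma intersection_mat_chain_singleton: "intersection_mat (chain [w]) = form1 (of_int w)"
  by (rule eq_matI) (auto simp: index_intersection_mat_chain)

lemma inertia_odd_zeros: "inertia (intersection_mat (chain (replicate (2 * k + 1) 0))) = (k, k, 1)"
  using inertia_chain_zeros[of "[0]" "[0]" k] unfolding replicate_odd
  by (simp add: intersection_mat_chain_singleton form_equiv_refl[OF form1_carrier]
    del: diag_block_mat.simps(2))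

lemma discriminant_even_zeros: "discriminant (chain (replicate (2 * k) 0)) = (-1) ^ k"
  using discriminant_zeros[of k "[]"]
  by (simp add: discriminant_def intersection_mat_chain_Nil)

lemma discriminant_odd_zeros: "discriminant (chain (replicate (2 * k + 1) 0)) = 0"
proof -
  have "discriminant (chain [0]) = 0"
    unfolding discriminant_def intersection_mat_chain_singleton
    by (subst det_single) auto
  then show ?thesis unfolding replicate_odd discriminant_zeros by simp
qed

text \<open>The sum defining \<open>null_index\<close> equals 1, so it does not range over the empty
  set.\<close>

lemma odd_zeros_eigenvalue:
  assumes "odd m"
  shows "eigenvalue (intersection_mat (chain (replicate m 0))) 0"
proof -
  from assms obtain k where "m = 2 * k + 1" by (elim oddE)
  then have "null_index (intersection_mat (chain (replicate m 0))) = 1"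
    using inertia_odd_zeros[of k] by (simp add: inertia_def)
  then show ?thesis
    unfolding null_index_def by (metis (mono_tags, lifting) Collect_empty_eq sum.empty zero_neq_one)
qed

lemma zeros_index:
  "neg_index (intersection_mat (chain (replicate m 0))) = m div 2"
  "pos_index (intersection_mat (chain (replicate m 0))) = m div 2"
proof -
  have "\<exists>k. m = 2 * k \<or> m = 2 * k + 1" by presburger
  then obtain k where "m = 2 * k \<or> m = 2 * k + 1" ..
  then show "neg_index (intersection_mat (chain (replicate m 0))) = m div 2"
    "pos_index (intersection_mat (chain (replicate m 0))) = m div 2"
    using inertia_even_zeros[of k] inertia_odd_zeros[of k] by (auto simp: inertia_def)
qed

lemma chain_zeros_split:
  "intersection_mat (chain (replicate (2 * k) 0 @ ws)) \<sim>\<^sub>f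
    diag_block_mat [intersection_mat (chain ws), intersection_mat (chain (replicate (2 * k) 0))]"
  "diag_block_mat [intersection_mat (chain ws), intersection_mat (chain (replicate (2 * k) 0))] \<sim>\<^sub>f
    diag_block_mat (intersection_mat (chain ws) # replicate k (form2 0 0))"
proof -
  note Cons = diag_block_mat_Cons[of "intersection_mat (chain ws)"]
  have refl: "intersection_mat (chain ws) \<sim>\<^sub>f intersection_mat (chain ws)"
    by (rule form_equiv_refl) auto
  show 2: "diag_block_mat [intersection_mat (chain ws), intersection_mat (chain (replicate (2 * k) 0))]
    \<sim>\<^sub>f diag_block_mat (intersection_mat (chain ws) # replicate k (form2 0 0))"
    unfolding Cons diag_block_mat_singleton
    by (rule form_equiv_direct_sum[OF refl all_zeros_equiv])
  show "intersection_mat (chain (replicate (2 * k) 0 @ ws)) \<sim>\<^sub>f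
    diag_block_mat [intersection_mat (chain ws), intersection_mat (chain (replicate (2 * k) 0))]"
    unfolding Cons
    by (rule form_equiv_trans[OF chain_zeros_equiv form_equiv_sym[OF 2[unfolded Cons]]])
qed

text \<open>Negativity of the reduced weights is used twice: nonzero pivots make the elimination
  possible, and their sign makes every one of them count towards the negative index.\<close>

lemma
  assumes "\<forall>w \<in> set ws. w \<le> -2"
  shows negative_chain_diagonal: "intersection_mat (chain (replicate (2 * k) 0 @ ws)) \<sim>\<^sub>f
      diag_block_mat (map (\<lambda>i. form1 (reduced_weight ws i)) [0..<length ws]
        @ [intersection_mat (chain (replicate (2 * k) 0))])"
    and negative_chain_index:
      "neg_index (intersection_mat (chain (replicate (2 * k) 0 @ ws))) = length ws + k"
      "pos_index (intersection_mat (chain (replicate (2 * k) 0 @ ws))) = k"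
proof -
  let ?d = "map (reduced_weight ws) [0..<length ws]"
  have neg: "reduced_weight ws i < 0" if "i < length ws" for i
    using assms that by (rule reduced_weight_neg)
  then have diag: "intersection_mat (chain ws) \<sim>\<^sub>f
    diag_block_mat (map (\<lambda>i. form1 (reduced_weight ws i)) [0..<length ws])"
    by (intro chain_diagonal) force
  let ?Z = "intersection_mat (chain (replicate (2 * k) 0))"
  have Z: "?Z \<sim>\<^sub>f ?Z" by (rule form_equiv_refl) auto
  note split = chain_zeros_split(1)[of k ws,
    unfolded diag_block_mat_Cons[of "intersection_mat (chain ws)"] diag_block_mat_singleton]
  show "intersection_mat (chain (replicate (2 * k) 0 @ ws)) \<sim>\<^sub>f
    diag_block_mat (map (\<lambda>i. form1 (reduced_weight ws i)) [0..<length ws] @ [?Z])"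
    unfolding diag_block_mat_append_direct_sum diag_block_mat_singleton
    by (rule form_equiv_trans[OF split form_equiv_direct_sum[OF diag Z]])
  have "intersection_mat (chain ws) \<sim>\<^sub>f diag_block_mat (map form1 ?d)"
    using diag by (simp add: comp_def)
  moreover have "filter (\<lambda>x. x < 0) ?d = ?d" using neg by (auto simp: filter_id_conv)
  moreover have "filter (\<lambda>x. x > 0) ?d = []" using neg by (force simp: filter_empty_conv)
  ultimately have "inertia (intersection_mat (chain (replicate (2 * k) 0 @ ws)))
    = (k, length ws + k, length (filter (\<lambda>x. x = 0) ?d))"
    using inertia_chain_zeros by fastforce
  then show "neg_index (intersection_mat (chain (replicate (2 * k) 0 @ ws))) = length ws + k"
      "pos_index (intersection_mat (chain (replicate (2 * k) 0 @ ws))) = k"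
    by (simp_all add: inertia_def)
qed

theorem proposition4p11:
  shows
    "(\<forall>m::nat. m \<ge> 1 \<longrightarrow>
        (let A = intersection_mat (chain (replicate m 0)) in
           neg_index A = m div 2 \<and> pos_index A = m div 2 \<and> (odd m \<longrightarrow> eigenvalue A 0)))
   \<and> (\<forall>k::nat. inertia (intersection_mat (chain (replicate (2 * k) 0))) = (k, k, 0)
             \<and> inertia (intersection_mat (chain (replicate (2 * k + 1) 0))) = (k, k, 1)
             \<and> discriminant (chain (replicate (2 * k) 0)) = (-1) ^ k
             \<and> discriminant (chain (replicate (2 * k + 1) 0)) = 0)
   \<and> (\<forall>(k::nat) (ws::int list).
        (let n = length ws;
             L = chain (replicate (2 * k) 0 @ ws);
             L' = chain ws;
             Z = intersection_mat (chain (replicate (2 * k) 0)) in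
           intersection_mat L \<sim>\<^sub>f diag_block_mat [intersection_mat L', Z]
         \<and> diag_block_mat [intersection_mat L', Z]
             \<sim>\<^sub>f diag_block_mat (intersection_mat L' # replicate k (form2 0 0))
         \<and> ((\<forall>w \<in> set ws. w \<le> -2) \<longrightarrow>
               intersection_mat L
                 \<sim>\<^sub>f diag_block_mat (map (\<lambda>i. form1 (reduced_weight ws i)) [0..<n] @ [Z])
             \<and> neg_index (intersection_mat L) = n + k
             \<and> pos_index (intersection_mat L) = k
             \<and> discriminant L = (-1) ^ k * discriminant L')))"
  unfolding Let_def
  by (intro conjI allI impI)
    (assumption | rule zeros_index odd_zeros_eigenvalue inertia_even_zeros inertia_odd_zeros
      discriminant_even_zeros discriminant_odd_zeros chain_zeros_split negative_chain_diagonal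
      negative_chain_index discriminant_zeros)+

end
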